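(* Let $\varepsilon\in(0,1)$ be fixed and let $t_{\mathrm{mix}}(\varepsilon)$ be the mixing time of the one-sided $k$-transposition shuffle $P_{n,k}$ on $S_n$. As $n\to\infty$: - for $k=\Omega(n\log n)$, $t_{\mathrm{mix}}(\varepsilon)=\Theta(n)$; - for $k\in[n,n\log n]$, $t_{\mathrm{mix}}(\varepsilon)=O\left(\frac{n^2\log n}{k}\right)$; - for every $k\ge1$, $t_{\mathrm{mix}}(\varepsilon)=\Omega(n)$.
   Context: For $1\le i_1,\dots,i_k\le j\le n$ write $(j;i_1,\dots,i_k):=(j\,i_k)\cdots(j\,i_1)\in S_n$, where $(j\,j)$ is the identity. The one-sided $k$-transposition shuffle is the random walk on $S_n$ driven by the probability distribution $$P_{n,k}(\tau)=\sum_{\substack{1\le i_1,\dots,i_k\le j\le n\\ \tau=(j;i_1,\dots,i_k)}}\frac{1}{nj^k};$$ its transition matrix, also denoted $P_{n,k}$, is $P_{n,k}(x,x\tau)=P_{n,k}(\tau)$. $P_{n,k}^t(x,y)$ is the probability of moving from $x$ to $y$ in $t$ steps. With $U$ the uniform measure on $S_n$, $$d^{(n,k)}(t)=\frac12\sum_{y\in S_n}|P_{n,k}^t(\mathrm{id},y)-U(y)|,\qquad t_{\mathrm{mix}}(\varepsilon)=\min\{t: d^{(n,k)}(t)\le\varepsilon\}.$$ Here $k=k(n)$ may depend on $n$, and the implied constants may depend on $\varepsilon$. $\log$ is the natural logarithm. *)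

theory Defs
  imports Complex_Main "HOL-Combinatorics.Permutations" "HOL-Library.Landau_Symbols"
begin

definition Sym :: "nat \<Rightarrow> (nat \<Rightarrow> nat) set" where
  "Sym n = {\<sigma>. \<sigma> permutes {1..n}}"

text \<open>
  For a list \<open>[i\<^sub>1, \<dots>, i\<^sub>k]\<close> this is the composition
  \<open>(j i\<^sub>k) \<circ> \<dots> \<circ> (j i\<^sub>1)\<close>, i.e. \<open>(j i\<^sub>1)\<close> is applied first. Products in the symmetric
  group are read as compositions of functions throughout.
\<close>

definition one_sided :: "nat \<Rightarrow> nat list \<Rightarrow> nat \<Rightarrow> nat" where
  "one_sided j is = fold (\<lambda>i \<sigma>. transpose j i \<circ> \<sigma>) is id"

definition shuffle_prob :: "nat \<Rightarrow> nat \<Rightarrow> (nat \<Rightarrow> nat) \<Rightarrow> real" where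
  "shuffle_prob n k \<tau> =
     (\<Sum>(j, is) \<in> {(j, is). j \<in> {1..n} \<and> length is = k \<and> set is \<subseteq> {1..j} \<and> \<tau> = one_sided j is}.
        1 / (real n * real j ^ k))"

text \<open>The walk multiplies on the right, \<open>x \<mapsto> x \<circ> \<tau>\<close>, so the increment from \<open>x\<close> to \<open>y\<close> is
  \<open>inv x \<circ> y\<close>.\<close>

definition shuffle_trans :: "nat \<Rightarrow> nat \<Rightarrow> (nat \<Rightarrow> nat) \<Rightarrow> (nat \<Rightarrow> nat) \<Rightarrow> real" where
  "shuffle_trans n k x y = shuffle_prob n k (inv x \<circ> y)"

primrec shuffle_steps ::
    "nat \<Rightarrow> nat \<Rightarrow> nat \<Rightarrow> (nat \<Rightarrow> nat) \<Rightarrow> (nat \<Rightarrow> nat) \<Rightarrow> real" where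
  "shuffle_steps n k 0 x y = (if x = y then 1 else 0)"
| "shuffle_steps n k (Suc t) x y =
     (\<Sum>z\<in>Sym n. shuffle_steps n k t x z * shuffle_trans n k z y)"

definition tv_dist :: "nat \<Rightarrow> nat \<Rightarrow> nat \<Rightarrow> real" where
  "tv_dist n k t = 1 / 2 * (\<Sum>y\<in>Sym n. \<bar>shuffle_steps n k t id y - 1 / real (card (Sym n))\<bar>)"

text \<open>For \<open>n \<ge> 1\<close>, \<open>k \<ge> 1\<close> the chain is irreducible and aperiodic, so for \<open>\<epsilon> > 0\<close> the set of
  admissible \<open>t\<close> is nonempty and the minimum exists.\<close>

definition t_mix :: "nat \<Rightarrow> nat \<Rightarrow> real \<Rightarrow> nat" where
  "t_mix n k \<epsilon> = (LEAST t. tv_dist n k t \<le> \<epsilon>)"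

end

theory Submission imports Defs begin

text \<open>
  A step of the walk picks \<open>j\<close> uniformly and then \<open>k\<close> times swaps position \<open>j\<close> with a uniform
  position \<open>i \<le> j\<close>; call such a swap with \<open>j = n\<close> a star step.

  Upper bound: a strong stationary time for the star steps, in distributional form. Let \<open>S\<close> be a set
  of cards that are uniformly distributed over the positions they occupy, all other cards lying at
  known positions. A star step that picks up a card \<open>x \<notin> S\<close> from a known position puts it into
  position \<open>n\<close>; when a later star step swaps it into one of the \<open>|S| + 1\<close> positions not known to hold
  another card, which happens with probability \<open>(|S| + 1) / n\<close>, the card \<open>x\<close> may be added to \<open>S\<close>. So
  at most \<open>2 n H\<^sub>n\<close> star steps are needed on average before \<open>S\<close> is the full deck. The swaps with
  \<open>j < n\<close> move known cards to known positions and leave position \<open>n\<close> alone, so they do no harm.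
  Since star steps come in batches of \<open>k\<close>, at most \<open>2 n H\<^sub>n / k + 1\<close> batches are needed on average,
  that is \<open>n (2 n H\<^sub>n / k + 1)\<close> steps of the walk, and Markov's inequality bounds the mixing time.

  Lower bound: as long as \<open>j = n\<close> has not been picked, position \<open>n\<close> is fixed.
\<close>

subsection \<open>Averages and convex functionals\<close>

definition average :: "nat \<Rightarrow> (nat \<Rightarrow> 'a \<Rightarrow> real) \<Rightarrow> 'a \<Rightarrow> real" where
  "average m \<nu> y = (\<Sum>i = 1..m. \<nu> i y) / real m"

text \<open>Jensen's inequality for uniform finite mixtures, the only kind of randomness in the
  walk: both \<open>j\<close> and the indices are chosen uniformly. The functionals of interest are
  sums of future distances to uniformity.\<close>

definition average_convex :: "(('a \<Rightarrow> real) \<Rightarrow> real) \<Rightarrow> bool" where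
  "average_convex B \<longleftrightarrow> (\<forall>m \<nu>. 1 \<le> m \<longrightarrow> B (average m \<nu>) \<le> (\<Sum>i = 1..m. B (\<nu> i)) / real m)"

definition preserves_average :: "(('a \<Rightarrow> real) \<Rightarrow> ('a \<Rightarrow> real)) \<Rightarrow> bool" where
  "preserves_average A \<longleftrightarrow> (\<forall>m \<nu>. A (average m \<nu>) = average m (\<lambda>i. A (\<nu> i)))"

lemma average_convexD:
  "average_convex B \<Longrightarrow> 1 \<le> m \<Longrightarrow> B (average m \<nu>) \<le> (\<Sum>i = 1..m. B (\<nu> i)) / real m"
  by (simp add: average_convex_def)

lemma average_convex_comp:
  "average_convex B \<Longrightarrow> preserves_average A \<Longrightarrow> average_convex (\<lambda>\<nu>. B (A \<nu>))"
  by (simp add: average_convex_def preserves_average_def)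

lemma average_convex_sum:
  assumes "\<And>t. t \<in> T \<Longrightarrow> average_convex (B t)"
  shows "average_convex (\<lambda>\<nu>. \<Sum>t\<in>T. B t \<nu>)"
  unfolding average_convex_def
proof (intro allI impI)
  fix m :: nat and \<nu> assume m: "1 \<le> m"
  have "(\<Sum>t\<in>T. B t (average m \<nu>)) \<le> (\<Sum>t\<in>T. (\<Sum>i = 1..m. B t (\<nu> i)) / real m)"
    by (intro sum_mono average_convexD assms m)
  also have "\<dots> = (\<Sum>i = 1..m. \<Sum>t\<in>T. B t (\<nu> i)) / real m"
    by (subst sum.swap) (simp add: sum_divide_distrib)
  finally show "(\<Sum>t\<in>T. B t (average m \<nu>)) \<le> (\<Sum>i = 1..m. \<Sum>t\<in>T. B t (\<nu> i)) / real m" .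
qed

lemma preserves_average_funpow:
  "preserves_average A \<Longrightarrow> preserves_average (A ^^ k)"
  by (induction k) (auto simp: preserves_average_def)

lemma average_bound:
  assumes "average_convex B" "1 \<le> m" "\<And>i. i \<in> {1..m} \<Longrightarrow> B (\<nu> i) \<le> c"
  shows "B (average m \<nu>) \<le> c"
proof -
  have "B (average m \<nu>) \<le> (\<Sum>i = 1..m. B (\<nu> i)) / real m"
    by (rule average_convexD) fact+
  also have "\<dots> \<le> (\<Sum>i = 1..m. c) / real m"
    by (intro divide_right_mono sum_mono assms) auto
  finally show ?thesis using assms(2) by simp
qed

lemma sum_average:
  "(\<Sum>y\<in>A. average m \<nu> y) = (\<Sum>i = 1..m. \<Sum>y\<in>A. \<nu> i y) / real m"
  unfolding average_def by (subst sum.swap) (simp add: sum_divide_distrib)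

lemma average_average:
  "average m (\<lambda>i. average l (\<mu> i)) = average l (\<lambda>h. average m (\<lambda>i. \<mu> i h))"
proof
  fix y
  have "(\<Sum>i = 1..m. \<Sum>h = 1..l. \<mu> i h y) = (\<Sum>h = 1..l. \<Sum>i = 1..m. \<mu> i h y)"
    by (rule sum.swap)
  then show "average m (\<lambda>i. average l (\<mu> i)) y = average l (\<lambda>h. average m (\<lambda>i. \<mu> i h)) y"
    by (simp add: average_def flip: sum_divide_distrib)
qed

subsection \<open>The walk as an operator on functions\<close>

text \<open>The pushforward of a distribution: a transposition is its own inverse, so the mass at
  \<open>y\<close> after a swap of positions \<open>j\<close> and \<open>i\<close> was at
  \<open>y \<circ> transpose j i\<close> before.\<close>

definition star :: "nat \<Rightarrow> ((nat \<Rightarrow> nat) \<Rightarrow> real) \<Rightarrow> (nat \<Rightarrow> nat) \<Rightarrow> real" where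
  "star j \<nu> = average j (\<lambda>i y. \<nu> (y \<circ> transpose j i))"

lemma star_apply: "star j \<nu> y = (\<Sum>i = 1..j. \<nu> (y \<circ> transpose j i)) / real j"
  by (simp add: star_def average_def)

definition walk :: "nat \<Rightarrow> nat \<Rightarrow> ((nat \<Rightarrow> nat) \<Rightarrow> real) \<Rightarrow> (nat \<Rightarrow> nat) \<Rightarrow> real" where
  "walk n k \<nu> = average n (\<lambda>j. (star j ^^ k) \<nu>)"

definition dirac_id :: "(nat \<Rightarrow> nat) \<Rightarrow> real" where
  "dirac_id y = (if y = id then 1 else 0)"

definition tv :: "nat \<Rightarrow> ((nat \<Rightarrow> nat) \<Rightarrow> real) \<Rightarrow> real" where
  "tv n \<nu> = 1 / 2 * (\<Sum>y\<in>Sym n. \<bar>\<nu> y - 1 / real (card (Sym n))\<bar>)"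

lemma finite_Sym: "finite (Sym n)"
  unfolding Sym_def by (rule finite_permutations) simp

lemma card_Sym: "card (Sym n) = fact n"
  unfolding Sym_def by (rule card_permutations) auto

lemma Sym_comp: "f \<in> Sym n \<Longrightarrow> g \<in> Sym n \<Longrightarrow> f \<circ> g \<in> Sym n"
  unfolding Sym_def using permutes_compose by blast

lemma Sym_inv: "f \<in> Sym n \<Longrightarrow> inv f \<in> Sym n"
  unfolding Sym_def using permutes_inv by blast

lemma transpose_in_Sym: "i \<in> {1..j} \<Longrightarrow> j \<le> n \<Longrightarrow> transpose j i \<in> Sym n"
  unfolding Sym_def by (auto intro!: permutes_swap_id)

lemma preserves_average_star: "preserves_average (star j)"
  unfolding preserves_average_def
proof (intro allI)
  fix m \<nu>
  have "star j (average m \<nu>) = average j (\<lambda>i. average m (\<lambda>h y. \<nu> h (y \<circ> transpose j i)))"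
    by (simp add: fun_eq_iff star_apply average_def)
  also have "\<dots> = average m (\<lambda>h. average j (\<lambda>i y. \<nu> h (y \<circ> transpose j i)))"
    by (rule average_average)
  finally show "star j (average m \<nu>) = average m (\<lambda>i. star j (\<nu> i))"
    by (simp add: star_def)
qed

lemma average_convex_star_funpow: "average_convex B \<Longrightarrow> average_convex (\<lambda>\<nu>. B ((star j ^^ k) \<nu>))"
  by (rule average_convex_comp[OF _ preserves_average_funpow[OF preserves_average_star]])

lemma preserves_average_walk: "preserves_average (walk n k)"
proof -
  have "(star j ^^ k) (average m \<nu>) = average m (\<lambda>i. (star j ^^ k) (\<nu> i))" for j m \<nu>
    using preserves_average_funpow[OF preserves_average_star] by (simp add: preserves_average_def)
  then show ?thesis
    unfolding preserves_average_def walk_def by (simp only:) (intro allI average_average)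
qed

lemma average_convex_tv: "average_convex (tv n)"
  unfolding average_convex_def
proof (intro allI impI)
  fix m :: nat and \<nu> :: "nat \<Rightarrow> (nat \<Rightarrow> nat) \<Rightarrow> real" assume m: "1 \<le> m"
  define u where "u = 1 / real (card (Sym n))"
  have "\<bar>average m \<nu> y - u\<bar> \<le> (\<Sum>i = 1..m. \<bar>\<nu> i y - u\<bar>) / real m" for y
  proof -
    have "average m \<nu> y - u = (\<Sum>i = 1..m. \<nu> i y - u) / real m"
      using m by (simp add: average_def sum_subtractf diff_divide_distrib)
    then show ?thesis
      by (simp add: divide_right_mono sum_abs)
  qed
  then have "(\<Sum>y\<in>Sym n. \<bar>average m \<nu> y - u\<bar>)
      \<le> (\<Sum>y\<in>Sym n. (\<Sum>i = 1..m. \<bar>\<nu> i y - u\<bar>) / real m)"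
    by (intro sum_mono)
  also have "\<dots> = (\<Sum>i = 1..m. \<Sum>y\<in>Sym n. \<bar>\<nu> i y - u\<bar>) / real m"
    by (subst sum.swap) (simp add: sum_divide_distrib)
  finally show "tv n (average m \<nu>) \<le> (\<Sum>i = 1..m. tv n (\<nu> i)) / real m"
    unfolding tv_def u_def by (simp add: sum_divide_distrib[symmetric] sum_distrib_left[symmetric])
qed

section \<open>Identification of the operator with the transition matrix\<close>

lemma one_sided_Cons: "one_sided j (i # is) = one_sided j is \<circ> transpose j i"
proof -
  \<comment> \<open>Each fold step composes on the left, so the initial value stays as the rightmost
    factor; this needs an arbitrary start in place of \<open>id\<close>.\<close>
  have "fold (\<lambda>i \<sigma>. transpose j i \<circ> \<sigma>) is \<tau> = fold (\<lambda>i \<sigma>. transpose j i \<circ> \<sigma>) is id \<circ> \<tau>"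
    for \<tau> :: "nat \<Rightarrow> nat"
  proof (induction "is" arbitrary: \<tau>)
    case (Cons a "is")
    show ?case
      using Cons[of "transpose j a \<circ> \<tau>"] Cons[of "transpose j a"] by (simp add: comp_assoc)
  qed simp
  from this[of "transpose j i"] show ?thesis by (simp add: one_sided_def)
qed

lemma one_sided_Sym:
  "set is \<subseteq> {1..j} \<Longrightarrow> j \<le> n \<Longrightarrow> one_sided j is \<in> Sym n"
proof (induction "is")
  case Nil
  then show ?case
    using permutes_id[of "{1..n}"] by (simp add: one_sided_def Sym_def id_def)
next
  case (Cons a "is")
  then show ?case
    unfolding one_sided_Cons by (intro Sym_comp transpose_in_Sym) auto
qed

text \<open>The walk multiplies on the right, so the mass at \<open>y\<close> comes from
  \<open>y\<close> times the inverse of the increment. The head of the list is the rightmost factor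
  of the increment, hence the first one undone; it corresponds to the outermost
  \<open>star\<close>.\<close>

lemma star_funpow_eq:
  "(star j ^^ k) \<nu> y =
     (\<Sum>is | length is = k \<and> set is \<subseteq> {1..j}. \<nu> (y \<circ> inv (one_sided j is))) / real j ^ k"
proof (induction k arbitrary: y)
  case 0
  have "{is. length is = 0 \<and> set is \<subseteq> {1..j}} = {[]}" by auto
  then show ?case by (simp add: one_sided_def)
next
  case (Suc k)
  let ?L = "\<lambda>k. {is. length is = k \<and> set is \<subseteq> {1..j}}"
  have L: "?L (Suc k) = (\<lambda>(i, is). i # is) ` ({1..j} \<times> ?L k)"
    by (auto simp: length_Suc_conv image_iff)
  have inv_eq: "inv (one_sided j (i # is)) = transpose j i \<circ> inv (one_sided j is)"
    if "set is \<subseteq> {1..j}" for i "is"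
  proof -
    have "bij (one_sided j is)"
      using one_sided_Sym[OF that order_refl] by (auto simp: Sym_def permutes_bij)
    then show ?thesis
      unfolding one_sided_Cons by (subst o_inv_distrib) auto
  qed
  have "(\<Sum>is\<in>?L (Suc k). \<nu> (y \<circ> inv (one_sided j is)))
      = (\<Sum>(i, is)\<in>{1..j} \<times> ?L k. \<nu> (y \<circ> inv (one_sided j (i # is))))"
    unfolding L by (subst sum.reindex) (auto simp: inj_on_def case_prod_unfold)
  also have "\<dots> = (\<Sum>(i, is)\<in>{1..j} \<times> ?L k. \<nu> ((y \<circ> transpose j i) \<circ> inv (one_sided j is)))"
    by (intro sum.cong) (auto simp: inv_eq comp_assoc)
  also have "\<dots> = (\<Sum>i = 1..j. \<Sum>is\<in>?L k. \<nu> ((y \<circ> transpose j i) \<circ> inv (one_sided j is)))"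
    by (simp add: sum.cartesian_product)
  finally have sum_Suc: "(\<Sum>is\<in>?L (Suc k). \<nu> (y \<circ> inv (one_sided j is))) = \<dots>" .
  have "(star j ^^ Suc k) \<nu> y = (\<Sum>i = 1..j. (star j ^^ k) \<nu> (y \<circ> transpose j i)) / real j"
    by (simp add: star_apply)
  also have "\<dots> = (\<Sum>is\<in>?L (Suc k). \<nu> (y \<circ> inv (one_sided j is))) / real j ^ Suc k"
    unfolding sum_Suc Suc by (simp flip: sum_divide_distrib)
  finally show ?case .
qed

lemma walk_eq:
  assumes "y \<in> Sym n"
  shows "walk n k \<nu> y = (\<Sum>z\<in>Sym n. \<nu> z * shuffle_trans n k z y)"
proof -
  let ?L = "\<lambda>j. {is. length is = k \<and> set is \<subseteq> {1..j::nat}}"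
  have fin: "finite (?L j)" for j
    using finite_lists_length_eq[of "{1..j}" k] by (simp add: conj_commute)
  have trans: "shuffle_trans n k z y
      = (\<Sum>j = 1..n. \<Sum>is\<in>?L j. if z = y \<circ> inv (one_sided j is) then 1 / (real n * real j ^ k) else 0)"
    if "z \<in> Sym n" for z
  proof -
    have eq: "inv z \<circ> y = one_sided j is \<longleftrightarrow> z = y \<circ> inv (one_sided j is)"
      if "j \<le> n" "is \<in> ?L j" for j "is"
    proof -
      have b: "bij (one_sided j is)" "bij z"
        using one_sided_Sym[of "is" j n] that \<open>z \<in> Sym n\<close> by (auto simp: Sym_def permutes_bij)
      show ?thesis
      proof
        assume "inv z \<circ> y = one_sided j is"
        then have "z \<circ> one_sided j is = y"
          by (metis b(2) bij_is_surj comp_assoc id_comp surj_iff)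
        then show "z = y \<circ> inv (one_sided j is)"
          by (metis b(1) bij_is_surj comp_assoc comp_id surj_iff)
      next
        assume "z = y \<circ> inv (one_sided j is)"
        then have "z \<circ> one_sided j is = y"
          by (metis b(1) bij_is_inj comp_assoc comp_id inj_iff)
        then show "inv z \<circ> y = one_sided j is"
          by (metis b(2) bij_is_inj comp_assoc id_comp inj_iff)
      qed
    qed
    have "shuffle_trans n k z y
        = (\<Sum>(j, is)\<in>{(j, is)\<in>Sigma {1..n} ?L. z = y \<circ> inv (one_sided j is)}. 1 / (real n * real j ^ k))"
      unfolding shuffle_trans_def shuffle_prob_def
      by (intro sum.cong) (use eq in auto)
    also have "\<dots> = (\<Sum>(j, is)\<in>Sigma {1..n} ?L.
        if z = y \<circ> inv (one_sided j is) then 1 / (real n * real j ^ k) else 0)"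
      by (intro sum.mono_neutral_cong_left finite_SigmaI fin) (auto split: if_splits)
    finally show ?thesis
      by (subst sum.Sigma) (use fin in auto)
  qed
  have "(\<Sum>z\<in>Sym n. \<nu> z * shuffle_trans n k z y)
      = (\<Sum>z\<in>Sym n. \<Sum>j = 1..n. \<Sum>is\<in>?L j.
          if z = y \<circ> inv (one_sided j is) then \<nu> z / (real n * real j ^ k) else 0)"
    by (intro sum.cong refl) (simp add: trans sum_distrib_left if_distrib cong: if_cong)
  also have "\<dots> = (\<Sum>j = 1..n. \<Sum>z\<in>Sym n. \<Sum>is\<in>?L j.
          if z = y \<circ> inv (one_sided j is) then \<nu> z / (real n * real j ^ k) else 0)"
    by (rule sum.swap)
  \<comment> \<open>With the sum over \<open>z\<close> innermost, each pair of \<open>j\<close> and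
    a list selects exactly one predecessor \<open>z\<close> of \<open>y\<close>.\<close>
  also have "\<dots> = (\<Sum>j = 1..n. \<Sum>is\<in>?L j. \<Sum>z\<in>Sym n.
          if z = y \<circ> inv (one_sided j is) then \<nu> z / (real n * real j ^ k) else 0)"
    by (intro sum.cong refl sum.swap)
  also have "\<dots> = (\<Sum>j = 1..n. \<Sum>is\<in>?L j. \<nu> (y \<circ> inv (one_sided j is)) / (real n * real j ^ k))"
  proof (intro sum.cong refl)
    fix j "is" assume "j \<in> {1..n}" "is \<in> ?L j"
    then have "y \<circ> inv (one_sided j is) \<in> Sym n"
      using assms by (intro Sym_comp Sym_inv one_sided_Sym) auto
    then show "(\<Sum>z\<in>Sym n. if z = y \<circ> inv (one_sided j is) then \<nu> z / (real n * real j ^ k) else 0)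
        = \<nu> (y \<circ> inv (one_sided j is)) / (real n * real j ^ k)"
      by (simp add: finite_Sym)
  qed
  also have "\<dots> = walk n k \<nu> y"
    by (simp add: walk_def average_def star_funpow_eq sum_divide_distrib mult.commute)
  finally show ?thesis ..
qed

lemma shuffle_steps_eq:
  "y \<in> Sym n \<Longrightarrow> shuffle_steps n k t id y = (walk n k ^^ t) dirac_id y"
proof (induction t arbitrary: y)
  case 0
  then show ?case by (auto simp: dirac_id_def)
next
  case (Suc t)
  then show ?case by (simp add: walk_eq)
qed

lemma tv_dist_eq: "tv_dist n k t = tv n ((walk n k ^^ t) dirac_id)"
  by (simp add: tv_dist_def tv_def shuffle_steps_eq)

subsection \<open>Uniform distributions on cosets\<close>

text \<open>The set \<open>S\<close> consists of cards and \<open>g\<close> maps positions to cards, so every card \<open>x \<notin> S\<close> sits at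
  position \<open>inv g x\<close> under this distribution.\<close>

definition coset_dist :: "nat set \<Rightarrow> (nat \<Rightarrow> nat) \<Rightarrow> (nat \<Rightarrow> nat) \<Rightarrow> real" where
  "coset_dist S g y = (if y \<circ> inv g permutes S then 1 / fact (card S) else 0)"

lemma coset_dist_transpose:
  assumes "bij g"
  shows "coset_dist S g (y \<circ> transpose j i) = coset_dist S (g \<circ> transpose j i) y"
proof -
  have "inv (g \<circ> transpose j i) = transpose j i \<circ> inv g"
    using assms by (subst o_inv_distrib) auto
  then show ?thesis by (simp add: coset_dist_def comp_assoc)
qed

lemma star_coset_dist:
  assumes "bij g"
  shows "star j (coset_dist S g) = average j (\<lambda>i. coset_dist S (g \<circ> transpose j i))"
  by (simp add: star_def fun_eq_iff coset_dist_transpose[OF assms] average_def)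

text \<open>The permutations \<open>h\<close> of \<open>insert x S\<close> split into
  \<open>card S + 1\<close> cosets of the permutations of \<open>S\<close>, according to the point
  \<open>q\<close> with \<open>h q = x\<close>. Averaging the uniform distributions on these cosets
  gives the uniform distribution on the larger group, which is how \<open>x\<close> gets
  absorbed.\<close>

lemma sum_coset_dist_insert:
  assumes "finite S" "x \<notin> S" "bij g"
  shows "(\<Sum>q\<in>insert x S. coset_dist S (transpose x q \<circ> g) y)
       = real (card S + 1) * coset_dist (insert x S) g y"
proof -
  define h where "h = y \<circ> inv g"
  have *: "coset_dist S (transpose x q \<circ> g) y
      = (if h permutes insert x S \<and> q = inv h x then 1 / fact (card S) else 0)" 
    if q: "q \<in> insert x S" for q
  proof -
    have inv_eq: "inv (transpose x q \<circ> g) = inv g \<circ> transpose x q"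
      using assms(3) by (subst o_inv_distrib) auto
    have "h \<circ> transpose x q permutes S \<longleftrightarrow> h permutes insert x S \<and> q = inv h x"
    proof
      assume a: "h \<circ> transpose x q permutes S"
      have t: "transpose x q permutes insert x S" using q by (intro permutes_swap_id) auto
      have "h \<circ> transpose x q \<circ> transpose x q permutes insert x S"
        by (intro permutes_compose t permutes_subset[OF a]) auto
      then have h: "h permutes insert x S" by (simp add: comp_assoc)
      have "(h \<circ> transpose x q) x = x"
        using a assms(2) permutes_not_in by metis
      then have "h q = x" by simp
      then show "h permutes insert x S \<and> q = inv h x"
        using h permutes_inv_eq[OF h] by metis
    next
      assume a: "h permutes insert x S \<and> q = inv h x"
      then have hq: "h q = x" by (metis permutes_inv_eq)
      have "h \<circ> transpose x q permutes insert x S"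
        using a q by (intro permutes_compose permutes_swap_id) auto
      then show "h \<circ> transpose x q permutes S"
        by (rule permutes_superset) (auto simp: hq)
    qed
    then show ?thesis
      by (simp add: coset_dist_def inv_eq h_def comp_assoc)
  qed
  have fin: "finite (insert x S)" using assms(1) by simp
  show ?thesis
  proof (cases "h permutes insert x S")
    case True
    then have "inv h x \<in> insert x S"
      using permutes_in_image[OF permutes_inv[OF True], of x] by simp
    then have "(\<Sum>q\<in>insert x S. coset_dist S (transpose x q \<circ> g) y) = 1 / fact (card S)"
      using True fin by (simp add: * del: sum.insert)
    also have "\<dots> = real (card S + 1) * (1 / fact (card S + 1))"
      by (simp only: fact_Suc Suc_eq_plus1[symmetric]) (simp del: of_nat_Suc)
    finally show ?thesis
      using True assms by (simp add: coset_dist_def h_def)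
  next
    case False
    then have "(\<Sum>q\<in>insert x S. coset_dist S (transpose x q \<circ> g) y) = 0"
      by (simp add: * del: sum.insert)
    then show ?thesis using False by (simp add: coset_dist_def h_def)
  qed
qed

text \<open>At the start every card is at a known position.\<close>

lemma dirac_id_eq_coset_dist: "dirac_id = coset_dist {} id"
  by (simp add: fun_eq_iff dirac_id_def coset_dist_def)

lemma tv_coset_dist_le_1:
  assumes "S \<subseteq> {1..n}" "g \<in> Sym n"
  shows "tv n (coset_dist S g) \<le> 1"
proof -
  have g: "g permutes {1..n}" using assms by (simp add: Sym_def)
  have fin: "finite S" using assms(1) finite_subset by blast
  have sub: "{y. y \<circ> inv g permutes S} \<subseteq> Sym n"
  proof safe
    fix y assume "y \<circ> inv g permutes S"
    then have "y \<circ> inv g \<circ> g permutes {1..n}"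
      by (intro permutes_compose[OF g] permutes_subset[OF _ assms(1)])
    then show "y \<in> Sym n" using permutes_inv_o[OF g] by (simp add: Sym_def comp_assoc)
  qed
  \<comment> \<open>The support is a translate of the group of permutations of \<open>S\<close>, so
    the total mass is 1; two probability vectors are at L1 distance at most 2.\<close>
  have "bij_betw (\<lambda>h. h \<circ> g) {h. h permutes S} {y. y \<circ> inv g permutes S}"
    by (rule bij_betw_byWitness[where f' = "\<lambda>y. y \<circ> inv g"])
       (auto simp: comp_assoc permutes_inv_o[OF g])
  then have card: "card {y. y \<circ> inv g permutes S} = fact (card S)"
    using bij_betw_same_card card_permutations[OF refl fin] by metis
  have "(\<Sum>y\<in>Sym n. coset_dist S g y) = (\<Sum>y\<in>{y. y \<circ> inv g permutes S}. 1 / fact (card S))"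
    unfolding coset_dist_def
    by (rule sum.mono_neutral_cong_right) (use sub finite_Sym in auto)
  also have "\<dots> = 1" by (simp add: card)
  finally have mass: "(\<Sum>y\<in>Sym n. coset_dist S g y) = 1" .
  have "(\<Sum>y\<in>Sym n. \<bar>coset_dist S g y - 1 / real (card (Sym n))\<bar>)
      \<le> (\<Sum>y\<in>Sym n. coset_dist S g y + 1 / real (card (Sym n)))"
    by (intro sum_mono) (auto simp: coset_dist_def abs_le_iff)
  also have "\<dots> = 2" by (simp add: sum.distrib mass card_Sym)
  finally show ?thesis by (simp add: tv_def)
qed

lemma tv_coset_dist_full:
  assumes "g \<in> Sym n"
  shows "tv n (coset_dist {1..n} g) = 0"
proof -
  have "y \<circ> inv g permutes {1..n}" if "y \<in> Sym n" for y
    using Sym_comp[OF that Sym_inv[OF assms]] by (simp add: Sym_def)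
  then show ?thesis by (simp add: tv_def coset_dist_def card_Sym)
qed

subsection \<open>The potential\<close>

text \<open>The potential is the expected number of star steps until \<open>S\<close> is the full deck, where \<open>x\<close> is the
  card at position \<open>n\<close>: with \<open>|S| = r\<close>, picking up a card outside \<open>S\<close> takes \<open>n / (n - r)\<close> star steps
  on average and absorbing it takes \<open>n / (r + 1)\<close>.\<close>

definition full_potential :: "nat \<Rightarrow> nat \<Rightarrow> real" where
  "full_potential n s = (\<Sum>r\<in>{s..<n}. real n / (real n - real r) + real n / (real r + 1))"

definition potential :: "nat \<Rightarrow> nat set \<Rightarrow> nat \<Rightarrow> real" where
  "potential n S x =
     (if x \<in> S then full_potential n (card S)
      else real n / (real (card S) + 1) + full_potential n (card S + 1))"

text \<open>The offset \<open>b\<close> covers the waiting time for a batch of star steps. It must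
  vanish on the full deck, where the distance is already 0.\<close>

definition coset_bound :: "nat \<Rightarrow> real \<Rightarrow> real \<Rightarrow> nat set \<Rightarrow> nat \<Rightarrow> real" where
  "coset_bound n a b S x = a * potential n S x + (if S = {1..n} then 0 else b)"

definition bounded_on_cosets ::
    "nat \<Rightarrow> (((nat \<Rightarrow> nat) \<Rightarrow> real) \<Rightarrow> real) \<Rightarrow> real \<Rightarrow> real \<Rightarrow> bool" where
  "bounded_on_cosets n B a b \<longleftrightarrow>
     (\<forall>S g. S \<subseteq> {1..n} \<longrightarrow> g \<in> Sym n \<longrightarrow> B (coset_dist S g) \<le> coset_bound n a b S (g n))"

lemma full_potential_step:
  assumes "s < n"
  shows "full_potential n s
    = real n / (real n - real s) + real n / (real s + 1) + full_potential n (s + 1)"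
  unfolding full_potential_def using assms by (simp add: sum.atLeast_Suc_lessThan)

lemma sum_reciprocals_le: "1 \<le> n \<Longrightarrow> (\<Sum>r<n. 1 / (real r + 1)) \<le> 1 + ln (real n)"
proof (induction n rule: nat_induct_at_least)
  case (Suc n)
  have "ln (real n / (real n + 1)) \<le> real n / (real n + 1) - 1"
    using Suc.hyps by (intro ln_le_minus_one) auto
  also have "\<dots> = - (1 / (real n + 1))" by (simp add: field_simps)
  finally have "1 / (real n + 1) \<le> ln (real (Suc n)) - ln (real n)"
    using Suc.hyps by (simp add: ln_div add.commute)
  with Suc.IH show ?case by simp
qed simp

lemma full_potential_0_le:
  assumes "1 \<le> n"
  shows "full_potential n 0 \<le> 2 * real n * (1 + ln (real n))"
proof -
  \<comment> \<open>Reversing the order of summation turns the pick-up times into the same harmonic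
    sum as the absorption times.\<close>
  have "(\<Sum>r<n. real n / (real n - real r)) = (\<Sum>r<n. real n / (real r + 1))"
    by (rule sum.reindex_bij_witness[where i = "\<lambda>r. n - Suc r" and j = "\<lambda>r. n - Suc r"])
       (auto simp: of_nat_diff)
  then have "full_potential n 0 = 2 * real n * (\<Sum>r<n. 1 / (real r + 1))"
    by (simp add: full_potential_def sum.distrib atLeast0LessThan sum_distrib_left)
  then show ?thesis
    using sum_reciprocals_le[OF assms] by (simp add: mult_left_mono)
qed

lemma full_potential_nonneg: "0 \<le> full_potential n s"
  unfolding full_potential_def by (intro sum_nonneg) auto

lemma potential_nonneg: "0 \<le> potential n S x"
  by (simp add: potential_def full_potential_nonneg)

lemma sum_Sym_reindex: "g \<in> Sym n \<Longrightarrow> (\<Sum>p = 1..n. F (g p)) = (\<Sum>q = 1..n. F q)"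
  unfolding Sym_def by (intro sum.permute[symmetric, unfolded o_def]) auto

lemma Sym_bij: "g \<in> Sym n \<Longrightarrow> bij g"
  by (auto simp: Sym_def permutes_bij)

lemma Sym_range: "g \<in> Sym n \<Longrightarrow> x \<in> {1..n} \<Longrightarrow> g x \<in> {1..n}"
  unfolding Sym_def by (simp only: mem_Collect_eq permutes_in_image)

lemma sum_if_mem:
  assumes "S \<subseteq> {1..n}"
  shows "(\<Sum>q = 1..n. if q \<in> S then u else v) = real (card S) * u + (real n - real (card S)) * v"
proof -
  have fin: "finite S" and le: "card S \<le> n"
    using assms finite_subset card_mono[OF _ assms] by auto
  have "{1..n} \<inter> {q. q \<in> S} = S" "{1..n} \<inter> - {q. q \<in> S} = {1..n} - S"
    using assms by auto
  then have "(\<Sum>q = 1..n. if q \<in> S then u else v) = (\<Sum>q\<in>S. u) + (\<Sum>q\<in>{1..n} - S. v)"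
    by (simp add: sum.If_cases)
  then show ?thesis
    using fin le assms by (simp add: card_Diff_subset of_nat_diff)
qed

lemma card_less_full: "S \<subseteq> {1..n} \<Longrightarrow> S \<noteq> {1..n} \<Longrightarrow> card S < n"
  using psubset_card_mono[of "{1..n}" S] by auto

text \<open>A star step brings a uniformly chosen card to position \<open>n\<close>. With
  probability \<open>(n - s) / n\<close>, where \<open>s = card S\<close>, it lies outside
  \<open>S\<close>, and then the potential is lower by \<open>n / (n - s)\<close>; the mean drop is
  exactly 1.\<close>

lemma sum_potential:
  assumes "S \<subseteq> {1..n}" "S \<noteq> {1..n}" "x \<in> S"
  shows "(\<Sum>q = 1..n. potential n S q) = real n * (potential n S x - 1)"
proof -
  define s where "s = card S"
  have s: "s < n" using card_less_full[OF assms(1,2)] by (simp add: s_def)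
  have "(\<Sum>q = 1..n. potential n S q) = real s * full_potential n s
      + (real n - real s) * (real n / (real s + 1) + full_potential n (s + 1))"
    unfolding potential_def s_def by (rule sum_if_mem[OF assms(1)])
  also have "real n / (real s + 1) + full_potential n (s + 1)
      = full_potential n s - real n / (real n - real s)"
    using full_potential_step[OF s] by simp
  also have "real s * full_potential n s
      + (real n - real s) * (full_potential n s - real n / (real n - real s))
      = real n * (full_potential n s - 1)"
  proof -
    have "(real n - real s) * (real n / (real n - real s)) = real n" using s by simp
    then show ?thesis unfolding right_diff_distrib by (simp add: algebra_simps)
  qed
  finally show ?thesis using assms(3) by (simp add: potential_def s_def)
qed

text \<open>Index the swaps by the card \<open>q = g p\<close> exchanged with
  \<open>x = g n\<close>. Those with \<open>q\<close> in \<open>insert x S\<close> yield precisely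
  the cosets that make up the uniform distribution on the larger group, so each of them may be
  replaced by that distribution without changing the average. The idle swap \<open>p = n\<close> is
  among them.\<close>

lemma star_coset_dist_merge:
  assumes "S \<subseteq> {1..n}" "g \<in> Sym n" "g n \<notin> S" "1 \<le> n"
  shows "star n (coset_dist S g) = average n (\<lambda>p.
           if g p \<in> insert (g n) S then coset_dist (insert (g n) S) g
           else coset_dist S (g \<circ> transpose n p))"
proof
  fix y
  define x where "x = g n"
  define S' where "S' = insert x S"
  define F where "F = (\<lambda>q. coset_dist S (transpose x q \<circ> g) y)"
  define G where "G = (\<lambda>q. if q \<in> S' then coset_dist S' g y else F q)"
  have fin: "finite S" using assms(1) finite_subset by blast
  have inj: "inj g" using Sym_bij[OF assms(2)] by (rule bij_is_inj)
  have swap: "g \<circ> transpose n p = transpose x (g p) \<circ> g" for p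
    using inj by (auto simp: fun_eq_iff transpose_def x_def dest: injD)
  have sub: "S' \<subseteq> {1..n}"
    using assms Sym_range[OF assms(2), of n] by (auto simp: S'_def x_def)
  have "(\<Sum>q\<in>S'. F q) = (\<Sum>q\<in>S'. G q)"
    using sum_coset_dist_insert[OF fin, of x g y] assms(3) fin Sym_bij[OF assms(2)]
    unfolding F_def G_def S'_def by (simp add: x_def)
  moreover have "(\<Sum>q\<in>{1..n} - S'. F q) = (\<Sum>q\<in>{1..n} - S'. G q)"
    by (intro sum.cong) (auto simp: G_def)
  ultimately have "(\<Sum>q = 1..n. F q) = (\<Sum>q = 1..n. G q)"
    using sum.subset_diff[OF sub, of F] sum.subset_diff[OF sub, of G] by simp
  then have FG: "(\<Sum>p = 1..n. F (g p)) = (\<Sum>p = 1..n. G (g p))"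
    using sum_Sym_reindex[OF assms(2), of F] sum_Sym_reindex[OF assms(2), of G] by simp
  have "star n (coset_dist S g) y = (\<Sum>p = 1..n. F (g p)) / real n"
    by (simp add: star_coset_dist[OF Sym_bij[OF assms(2)]] average_def F_def swap)
  also have "(\<Sum>p = 1..n. G (g p)) = (\<Sum>p = 1..n. (if g p \<in> insert (g n) S
      then coset_dist (insert (g n) S) g else coset_dist S (g \<circ> transpose n p)) y)"
    by (intro sum.cong) (auto simp: G_def F_def swap S'_def x_def)
  then have "(\<Sum>p = 1..n. F (g p)) / real n = average n (\<lambda>p.
           if g p \<in> insert (g n) S then coset_dist (insert (g n) S) g
           else coset_dist S (g \<circ> transpose n p)) y"
    unfolding FG average_def by simp
  finally show "star n (coset_dist S g) y = average n (\<lambda>p.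
           if g p \<in> insert (g n) S then coset_dist (insert (g n) S) g
           else coset_dist S (g \<circ> transpose n p)) y" .
qed

section \<open>Decrease of the potential along the walk\<close>

lemma bounded_on_cosetsD:
  "bounded_on_cosets n B a b \<Longrightarrow> S \<subseteq> {1..n} \<Longrightarrow> g \<in> Sym n \<Longrightarrow>
     B (coset_dist S g) \<le> coset_bound n a b S (g n)"
  by (simp add: bounded_on_cosets_def)

text \<open>The potential drops by 1 on average unless \<open>S\<close> is full. A bound \<open>a V + b\<close> can therefore absorb
  \<open>b / a\<close> star steps, which is how a whole batch of \<open>k\<close> of them is accounted for with
  \<open>a = n / k\<close> and \<open>b = n\<close>.\<close>

lemma bounded_on_cosets_star:
  assumes B: "average_convex B" "bounded_on_cosets n B a b" and n: "1 \<le> n" and ab: "0 \<le> a" "a \<le> b"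
  shows "bounded_on_cosets n (\<lambda>\<nu>. B (star n \<nu>)) a (b - a)"
  unfolding bounded_on_cosets_def
proof (intro allI impI)
  fix S g assume S: "S \<subseteq> {1..n}" and g: "g \<in> Sym n"
  define x where "x = g n"
  have fin: "finite S" using S finite_subset by blast
  have x: "x \<in> {1..n}" using Sym_range[OF g, of n] n by (simp add: x_def)
  have move: "B (coset_dist S (g \<circ> transpose n p)) \<le> coset_bound n a b S (g p)" if "p \<in> {1..n}" for p
    using bounded_on_cosetsD[OF B(2) S Sym_comp[OF g transpose_in_Sym[OF that order_refl]]] by simp
  show "B (star n (coset_dist S g)) \<le> coset_bound n a (b - a) S (g n)"
  proof (cases "x \<in> S")
    case True
    have "B (star n (coset_dist S g)) \<le> (\<Sum>p = 1..n. B (coset_dist S (g \<circ> transpose n p))) / real n"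
      unfolding star_coset_dist[OF Sym_bij[OF g]] by (rule average_convexD[OF B(1) n])
    also have "\<dots> \<le> (\<Sum>p = 1..n. coset_bound n a b S (g p)) / real n"
      by (intro divide_right_mono sum_mono move) auto
    also have "\<dots> = (\<Sum>q = 1..n. coset_bound n a b S q) / real n"
      by (simp only: sum_Sym_reindex[OF g, where F = "coset_bound n a b S"])
    also have "\<dots> = coset_bound n a (b - a) S x"
    \<comment> \<open>On the full deck the potential and the offset are both 0, so both sides
      vanish.\<close>
    proof (cases "S = {1..n}")
      case True
      then show ?thesis using x by (auto simp: coset_bound_def potential_def full_potential_def)
    next
      case False
      then have "(\<Sum>q = 1..n. coset_bound n a b S q) = a * (\<Sum>q = 1..n. potential n S q) + real n * b"
        by (simp add: coset_bound_def sum.distrib sum_distrib_left)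
      then have "(\<Sum>q = 1..n. coset_bound n a b S q) = real n * (a * (potential n S x - 1) + b)"
        unfolding sum_potential[OF S False \<open>x \<in> S\<close>] by (simp add: algebra_simps)
      then show ?thesis
        using n False by (simp add: coset_bound_def right_diff_distrib)
    qed
    finally show ?thesis by (simp add: x_def)
  next
    case False
    define S' where "S' = insert x S"
    \<comment> \<open>\<open>u\<close> bounds the value once \<open>x\<close> has joined
      \<open>S\<close>, \<open>v\<close> the value while the card at position \<open>n\<close> is
      still outside. Their difference \<open>a * n / (card S + 1)\<close> is gained with probability
      \<open>(card S + 1) / n\<close>, a mean drop of \<open>a\<close>.\<close>
    define u where "u = a * full_potential n (card S + 1) + b"
    define v where "v = a * (real n / (real (card S) + 1) + full_potential n (card S + 1)) + b"
    have S': "S' \<subseteq> {1..n}" "card S' = card S + 1" "S \<noteq> {1..n}"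
      using S x False fin by (auto simp: S'_def)
    define \<nu> where "\<nu> = (\<lambda>p. if g p \<in> S' then coset_dist S' g else coset_dist S (g \<circ> transpose n p))"
    have le: "B (\<nu> p) \<le> (if g p \<in> S' then u else v)" if p: "p \<in> {1..n}" for p
    proof (cases "g p \<in> S'")
      case True
      have "B (coset_dist S' g) \<le> coset_bound n a b S' x"
        using bounded_on_cosetsD[OF B(2) S'(1) g] by (simp add: x_def)
      \<comment> \<open>Only an inequality, because the offset \<open>b\<close> disappears if
        \<open>S'\<close> is the full deck.\<close>
      also have "\<dots> \<le> u"
        using ab S'(2) by (simp add: coset_bound_def potential_def u_def S'_def)
      finally show ?thesis using True by (simp add: \<nu>_def)
    next
      case out: False
      then have "coset_bound n a b S (g p) = v"
        using S' by (auto simp: coset_bound_def potential_def v_def S'_def)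
      then show ?thesis using move[OF p] out by (simp add: \<nu>_def)
    qed
    have "B (star n (coset_dist S g)) \<le> (\<Sum>p = 1..n. B (\<nu> p)) / real n"
    proof -
      have "star n (coset_dist S g) = average n \<nu>"
        unfolding \<nu>_def S'_def x_def
        using False by (intro star_coset_dist_merge[OF S g _ n]) (simp add: x_def)
      then show ?thesis by (simp only: average_convexD[OF B(1) n])
    qed
    also have "\<dots> \<le> (\<Sum>p = 1..n. if g p \<in> S' then u else v) / real n"
      by (intro divide_right_mono sum_mono le) auto
    also have "\<dots> = (\<Sum>q = 1..n. if q \<in> S' then u else v) / real n"
      by (simp only: sum_Sym_reindex[OF g, where F = "\<lambda>q. if q \<in> S' then u else v"])
    also have "\<dots> = (real (card S + 1) * u + (real n - real (card S + 1)) * v) / real n"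
      by (simp only: sum_if_mem[OF S'(1)] S'(2))
    also have "\<dots> = v - (real (card S + 1) * (v - u)) / real n"
      using n by (simp add: field_simps)
    also have "real (card S + 1) * (v - u) = a * real n"
      by (simp add: u_def v_def field_simps)
    also have "v - a * real n / real n = coset_bound n a (b - a) S x"
      using n False S'(3) by (simp add: coset_bound_def potential_def v_def)
    finally show ?thesis by (simp add: x_def)
  qed
qed

lemma bounded_on_cosets_star_funpow:
  assumes "average_convex B" "bounded_on_cosets n B a b" "1 \<le> n" "0 \<le> a" "real k * a \<le> b"
  shows "bounded_on_cosets n (\<lambda>\<nu>. B ((star n ^^ k) \<nu>)) a (b - real k * a)"
  using assms(5)
proof (induction k)
  case 0
  then show ?case using assms(2) by simp
next
  case (Suc k)
  have "bounded_on_cosets n (\<lambda>\<nu>. B ((star n ^^ k) \<nu>)) a (b - real k * a)"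
    using Suc.prems assms(4) by (intro Suc.IH) (simp add: algebra_simps)
  moreover have "average_convex (\<lambda>\<nu>. B ((star n ^^ k) \<nu>))"
    using assms(1) by (rule average_convex_star_funpow)
  \<comment> \<open>Induction backwards in time: the new star step acts first, and the functional is
    what remains after it.\<close>
  ultimately have "bounded_on_cosets n (\<lambda>\<nu>. B ((star n ^^ k) (star n \<nu>))) a (b - real k * a - a)"
    using assms Suc.prems by (intro bounded_on_cosets_star) (auto simp: algebra_simps)
  then show ?case by (simp add: funpow_Suc_right algebra_simps del: funpow.simps)
qed

text \<open>A swap of positions below \<open>n\<close> keeps \<open>S\<close> and the card at
  position \<open>n\<close>, on which alone the bound depends.\<close>

lemma bounded_on_cosets_star_below:
  assumes "average_convex B" "bounded_on_cosets n B a b" "1 \<le> j" "j < n"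
  shows "bounded_on_cosets n (\<lambda>\<nu>. B (star j \<nu>)) a b"
  unfolding bounded_on_cosets_def
proof (intro allI impI)
  fix S g assume S: "S \<subseteq> {1..n}" and g: "g \<in> Sym n"
  show "B (star j (coset_dist S g)) \<le> coset_bound n a b S (g n)"
    unfolding star_coset_dist[OF Sym_bij[OF g]]
  proof (rule average_bound[OF assms(1,3)])
    fix i assume i: "i \<in> {1..j}"
    then have "(g \<circ> transpose j i) n = g n"
      using assms(4) by (auto simp: transpose_def)
    moreover have "g \<circ> transpose j i \<in> Sym n"
      using assms(4) i by (intro Sym_comp g transpose_in_Sym) auto
    ultimately show "B (coset_dist S (g \<circ> transpose j i)) \<le> coset_bound n a b S (g n)"
      using bounded_on_cosetsD[OF assms(2) S] by metis
  qed
qed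

lemma bounded_on_cosets_star_below_funpow:
  assumes "average_convex B" "bounded_on_cosets n B a b" "1 \<le> j" "j < n"
  shows "bounded_on_cosets n (\<lambda>\<nu>. B ((star j ^^ k) \<nu>)) a b"
proof (induction k)
  case (Suc k)
  have "average_convex (\<lambda>\<nu>. B ((star j ^^ k) \<nu>))"
    using assms(1) by (rule average_convex_star_funpow)
  from bounded_on_cosets_star_below[OF this Suc assms(3,4)] show ?case
    by (simp add: funpow_Suc_right del: funpow.simps)
qed (use assms in simp)

text \<open>With probability \<open>1 / n\<close> the batch has \<open>j = n\<close> and its
  \<open>k\<close> star steps use up the whole offset \<open>n = k * a\<close>; otherwise nothing is
  lost. The mean offset is therefore \<open>(n - 1) / n * n = n - 1\<close>, so every step of the
  walk gains 1.\<close>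

lemma bounded_on_cosets_walk:
  assumes "average_convex B" "bounded_on_cosets n B (real n / real k) (real n)" "1 \<le> n" "1 \<le> k"
  shows "bounded_on_cosets n (\<lambda>\<nu>. B (walk n k \<nu>)) (real n / real k) (real n - 1)"
  unfolding bounded_on_cosets_def
proof (intro allI impI)
  fix S g assume S: "S \<subseteq> {1..n}" and g: "g \<in> Sym n"
  define a where "a = real n / real k"
  define V where "V = potential n S (g n)"
  define e :: real where "e = (if S = {1..n} then 0 else 1)"
  have bound_eq: "coset_bound n a b S (g n) = a * V + e * b" for b
    by (simp add: coset_bound_def V_def e_def)
  have ka: "real k * a = real n" using assms(4) by (simp add: a_def)
  have below: "B ((star j ^^ k) (coset_dist S g)) \<le> a * V + e * real n" if "j \<in> {1..n - 1}" for j
  proof -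
    have "bounded_on_cosets n (\<lambda>\<nu>. B ((star j ^^ k) \<nu>)) a (real n)"
      unfolding a_def using that
      by (intro bounded_on_cosets_star_below_funpow assms(1,2)) auto
    from bounded_on_cosetsD[OF this S g] show ?thesis by (simp only: bound_eq)
  qed
  have "bounded_on_cosets n (\<lambda>\<nu>. B ((star n ^^ k) \<nu>)) a (real n - real k * a)"
    using assms ka by (intro bounded_on_cosets_star_funpow) (auto simp: a_def)
  from bounded_on_cosetsD[OF this S g] have top: "B ((star n ^^ k) (coset_dist S g)) \<le> a * V"
    by (simp add: bound_eq ka)
  have split: "{1..n} = insert n {1..n - 1}" using assms(3) by auto
  have "B (walk n k (coset_dist S g)) \<le> (\<Sum>j = 1..n. B ((star j ^^ k) (coset_dist S g))) / real n"
    unfolding walk_def by (rule average_convexD[OF assms(1,3)])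
  also have "(\<Sum>j = 1..n. B ((star j ^^ k) (coset_dist S g)))
      = B ((star n ^^ k) (coset_dist S g)) + (\<Sum>j = 1..n - 1. B ((star j ^^ k) (coset_dist S g)))"
    using assms(3) by (subst split, subst sum.insert) auto
  also have "\<dots> \<le> a * V + (\<Sum>j = 1..n - 1. a * V + e * real n)"
    by (intro add_mono sum_mono top below)
  also have "\<dots> = real n * (a * V + e * (real n - 1))"
    using assms(3) by (simp add: of_nat_diff algebra_simps)
  finally show "B (walk n k (coset_dist S g)) \<le> coset_bound n (real n / real k) (real n - 1) S (g n)"
    using assms(3) by (simp add: bound_eq a_def[symmetric] divide_right_mono)
qed

text \<open>The sum over \<open>Suc m\<close> times is the present distance plus the sum over
  \<open>m\<close> times after one step. The distance is at most 1, and 0 on the full deck, so the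
  gain of 1 per step pays for it and the bound is the same for all \<open>m\<close>.\<close>

lemma sum_tv_bounded_on_cosets:
  assumes "1 \<le> n" "1 \<le> k"
  shows "bounded_on_cosets n (\<lambda>\<nu>. \<Sum>t<m. tv n ((walk n k ^^ t) \<nu>)) (real n / real k) (real n)"
proof (induction m)
  case 0
  show ?case by (simp add: bounded_on_cosets_def coset_bound_def potential_nonneg)
next
  case (Suc m)
  have "average_convex (\<lambda>\<nu>. \<Sum>t<m. tv n ((walk n k ^^ t) \<nu>))"
    by (rule average_convex_sum)
      (rule average_convex_comp[OF average_convex_tv preserves_average_funpow[OF preserves_average_walk]])
  note step = bounded_on_cosets_walk[OF this Suc assms]
  show ?case
    unfolding bounded_on_cosets_def
  proof (intro allI impI)
    fix S g assume S: "S \<subseteq> {1..n}" and g: "g \<in> Sym n"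
    have "tv n (coset_dist S g) \<le> (if S = {1..n} then 0 else 1)"
      using tv_coset_dist_le_1[OF S g] tv_coset_dist_full[OF g] by simp
    then show "(\<Sum>t<Suc m. tv n ((walk n k ^^ t) (coset_dist S g)))
        \<le> coset_bound n (real n / real k) (real n) S (g n)"
      using bounded_on_cosetsD[OF step S g] 
      by (simp add: sum.lessThan_Suc_shift funpow_Suc_right coset_bound_def split: if_splits
        del: sum.lessThan_Suc funpow.simps(2))
  qed
qed

section \<open>Upper bound for the mixing time\<close>

lemma sum_tv_dist_le:
  assumes "1 \<le> n" "1 \<le> k"
  shows "(\<Sum>t<m. tv_dist n k t) \<le> real n + 2 * (real n)\<^sup>2 * (1 + ln (real n)) / real k"
proof -
  have "id \<in> Sym n" by (simp add: Sym_def permutes_id)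
  from bounded_on_cosetsD[OF sum_tv_bounded_on_cosets[OF assms] _ this, of "{}"]
  have "(\<Sum>t<m. tv_dist n k t) \<le> real n / real k * (real n + full_potential n 1) + real n"
    using assms by (simp add: tv_dist_eq dirac_id_eq_coset_dist coset_bound_def potential_def)
  \<comment> \<open>From the identity the card at position \<open>n\<close> is picked up already,
    which saves the first term \<open>n / n\<close> of the potential.\<close>
  also have "\<dots> \<le> real n / real k * full_potential n 0 + real n"
    using full_potential_step[of 0 n] assms by (intro add_mono mult_left_mono) auto
  also have "\<dots> \<le> real n / real k * (2 * real n * (1 + ln (real n))) + real n"
    by (intro add_mono mult_left_mono full_potential_0_le assms) auto
  finally show ?thesis by (simp add: power2_eq_square algebra_simps add_divide_distrib)
qed

text \<open>Markov's inequality in summed form: each time before the mixing time contributes more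
  than \<epsilon> to a sum that is bounded uniformly in its length. The same bound shows that some
  time is admissible, so that \<open>LEAST\<close> is meaningful.\<close>

lemma t_mix_upper:
  assumes "1 \<le> n" "1 \<le> k" "0 < \<epsilon>"
  shows "tv_dist n k (t_mix n k \<epsilon>) \<le> \<epsilon>"
    and "\<epsilon> * real (t_mix n k \<epsilon>) \<le> real n + 2 * (real n)\<^sup>2 * (1 + ln (real n)) / real k"
proof -
  define K where "K = real n + 2 * (real n)\<^sup>2 * (1 + ln (real n)) / real k"
  have le: "\<epsilon> * real m \<le> K" if "\<And>t. t < m \<Longrightarrow> \<epsilon> < tv_dist n k t" for m
  proof -
    have "\<epsilon> * real m = (\<Sum>t<m. \<epsilon>)" by simp
    also have "\<dots> \<le> (\<Sum>t<m. tv_dist n k t)"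
      using that by (intro sum_mono less_imp_le) auto
    also have "\<dots> \<le> K" unfolding K_def by (rule sum_tv_dist_le[OF assms(1,2)])
    finally show ?thesis .
  qed
  have "\<exists>t. tv_dist n k t \<le> \<epsilon>"
  proof (rule ccontr)
    assume *: "\<nexists>t. tv_dist n k t \<le> \<epsilon>"
    obtain m where m: "K / \<epsilon> < real m" using reals_Archimedean2 by blast
    have "\<epsilon> * real m \<le> K" using * by (intro le) (simp add: not_le)
    with m assms(3) show False by (simp add: field_simps)
  qed
  then show "tv_dist n k (t_mix n k \<epsilon>) \<le> \<epsilon>"
    unfolding t_mix_def by (rule LeastI_ex)
  have "\<epsilon> < tv_dist n k t" if "t < t_mix n k \<epsilon>" for t
    using not_less_Least[OF that[unfolded t_mix_def]] by simp
  from le[OF this] show "\<epsilon> * real (t_mix n k \<epsilon>) \<le> real n + 2 * (real n)\<^sup>2 * (1 + ln (real n)) / real k"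
    by (simp add: K_def)
qed

subsection \<open>The lower bound\<close>

lemma sum_star:
  assumes "1 \<le> j" "\<And>i y. i \<in> {1..j} \<Longrightarrow> y \<in> A \<Longrightarrow> y \<circ> transpose j i \<in> A"
  shows "(\<Sum>y\<in>A. star j \<nu> y) = (\<Sum>y\<in>A. \<nu> y)"
proof -
  have "(\<Sum>y\<in>A. \<nu> (y \<circ> transpose j i)) = (\<Sum>y\<in>A. \<nu> y)" if "i \<in> {1..j}" for i
    by (rule sum.reindex_bij_witness[where i = "\<lambda>y. y \<circ> transpose j i"
          and j = "\<lambda>y. y \<circ> transpose j i"]) (use assms(2)[OF that] in \<open>auto simp: comp_assoc\<close>)
  then show ?thesis
    using assms(1) unfolding star_def sum_average by simp
qed

lemma sum_star_funpow:
  assumes "1 \<le> j" "\<And>i y. i \<in> {1..j} \<Longrightarrow> y \<in> A \<Longrightarrow> y \<circ> transpose j i \<in> A"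
  shows "(\<Sum>y\<in>A. (star j ^^ k) \<nu> y) = (\<Sum>y\<in>A. \<nu> y)"
proof (induction k)
  case (Suc k)
  have "(\<Sum>y\<in>A. star j ((star j ^^ k) \<nu>) y) = (\<Sum>y\<in>A. (star j ^^ k) \<nu> y)"
    by (rule sum_star) (fact assms)+
  with Suc show ?case by simp
qed simp

lemma star_funpow_nonneg: "(\<And>y. 0 \<le> \<nu> y) \<Longrightarrow> 0 \<le> (star j ^^ k) \<nu> y"
  by (induction k arbitrary: y) (auto simp: star_apply intro!: divide_nonneg_nonneg sum_nonneg)

lemma walk_nonneg: "(\<And>y. 0 \<le> \<nu> y) \<Longrightarrow> 0 \<le> walk n k \<nu> y"
  by (auto simp: walk_def average_def intro!: divide_nonneg_nonneg sum_nonneg star_funpow_nonneg)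

lemma sum_walk_Sym:
  assumes "1 \<le> n"
  shows "(\<Sum>y\<in>Sym n. walk n k \<nu> y) = (\<Sum>y\<in>Sym n. \<nu> y)"
proof -
  have "(\<Sum>y\<in>Sym n. (star j ^^ k) \<nu> y) = (\<Sum>y\<in>Sym n. \<nu> y)" if "j \<in> {1..n}" for j
    using that by (intro sum_star_funpow Sym_comp transpose_in_Sym) auto
  then show ?thesis using assms unfolding walk_def sum_average by simp
qed

text \<open>Each choice \<open>j < n\<close> maps the set of permutations fixing \<open>n\<close> to
  itself and conserves its mass; the choice \<open>j = n\<close> contributes a nonnegative amount,
  which is dropped.\<close>

lemma sum_walk_fix_ge:
  assumes "1 \<le> n" "\<And>y. 0 \<le> \<nu> y"
  defines "A \<equiv> {y \<in> Sym n. y n = n}"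
  shows "(1 - 1 / real n) * (\<Sum>y\<in>A. \<nu> y) \<le> (\<Sum>y\<in>A. walk n k \<nu> y)"
proof -
  have below: "(\<Sum>y\<in>A. (star j ^^ k) \<nu> y) = (\<Sum>y\<in>A. \<nu> y)" if j: "j \<in> {1..n - 1}" for j
  proof (rule sum_star_funpow)
    fix i y assume i: "i \<in> {1..j}" and y: "y \<in> A"
    have "y \<circ> transpose j i \<in> Sym n"
      using i j y by (intro Sym_comp transpose_in_Sym) (auto simp: A_def)
    then show "y \<circ> transpose j i \<in> A"
      using i j y by (auto simp: A_def transpose_def)
  qed (use j in auto)
  have split: "{1..n} = insert n {1..n - 1}" using assms(1) by auto
  have "(1 - 1 / real n) * (\<Sum>y\<in>A. \<nu> y) = (\<Sum>j = 1..n - 1. \<Sum>y\<in>A. \<nu> y) / real n"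
    using assms(1) by (simp add: of_nat_diff field_simps)
  also have "\<dots> = (\<Sum>j = 1..n - 1. \<Sum>y\<in>A. (star j ^^ k) \<nu> y) / real n"
    by (simp add: below)
  also have "\<dots> \<le> (\<Sum>j = 1..n. \<Sum>y\<in>A. (star j ^^ k) \<nu> y) / real n"
    by (intro divide_right_mono sum_mono2 sum_nonneg star_funpow_nonneg assms) auto
  finally show ?thesis unfolding walk_def sum_average .
qed

lemma card_fix_last: "1 \<le> n \<Longrightarrow> card {y \<in> Sym n. y n = n} = fact (n - 1)"
proof -
  assume n: "1 \<le> n"
  have "{y \<in> Sym n. y n = n} = {y. y permutes {1..n - 1}}"
  proof safe
    fix y assume "y \<in> Sym n" and fixed: "y n = n"
    then have "y permutes {1..n}" by (simp add: Sym_def)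
    then show "y permutes {1..n - 1}"
    proof (rule permutes_superset)
      fix x assume "x \<in> {1..n} - {1..n - 1}"
      then have "x = n" by auto
      with fixed show "y x = x" by simp
    qed
  next
    fix y assume y: "y permutes {1..n - 1}"
    then show "y \<in> Sym n" using permutes_subset[OF y, of "{1..n}"] by (auto simp: Sym_def)
    show "y n = n" using y n by (intro permutes_not_in[OF y]) auto
  qed
  then show ?thesis by (simp add: card_permutations)
qed

text \<open>The deviations from uniform sum to 0, so the excess on \<open>A\<close> is matched by a
  deficit on its complement; together they account for twice the excess.\<close>

lemma tv_ge:
  assumes "(\<Sum>y\<in>Sym n. \<nu> y) = 1" "A \<subseteq> Sym n"
  shows "(\<Sum>y\<in>A. \<nu> y) - real (card A) / real (card (Sym n)) \<le> tv n \<nu>"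
proof -
  define u where "u = 1 / real (card (Sym n))"
  have A: "(\<Sum>y\<in>A. \<nu> y - u) = (\<Sum>y\<in>A. \<nu> y) - real (card A) / real (card (Sym n))"
    by (simp add: sum_subtractf u_def)
  have total: "(\<Sum>y\<in>Sym n. \<nu> y - u) = 0"
    by (simp add: sum_subtractf assms(1) u_def card_Sym)
  note split = sum.subset_diff[OF assms(2) finite_Sym]
  have "(\<Sum>y\<in>A. \<nu> y - u) \<le> (\<Sum>y\<in>A. \<bar>\<nu> y - u\<bar>)"
    by (intro sum_mono) auto
  moreover have "- (\<Sum>y\<in>Sym n - A. \<nu> y - u) \<le> (\<Sum>y\<in>Sym n - A. \<bar>\<nu> y - u\<bar>)"
    unfolding sum_negf[symmetric] by (intro sum_mono) auto
  ultimately have "2 * (\<Sum>y\<in>A. \<nu> y - u) \<le> (\<Sum>y\<in>Sym n. \<bar>\<nu> y - u\<bar>)"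
    using total split[of "\<lambda>y. \<nu> y - u"] split[of "\<lambda>y. \<bar>\<nu> y - u\<bar>"] by linarith
  then show ?thesis using A unfolding tv_def u_def[symmetric] by linarith
qed

text \<open>The test event is that position \<open>n\<close> is fixed: the walk gives it at least
  \<open>(1 - 1/n)^t\<close>, hence at least \<open>1 - t/n\<close> by Bernoulli, and the uniform
  measure gives it \<open>1/n\<close>.\<close>

lemma tv_dist_ge:
  assumes "1 \<le> n"
  shows "1 - real t / real n - 1 / real n \<le> tv_dist n k t"
proof -
  define \<mu> where "\<mu> = (\<lambda>t. (walk n k ^^ t) dirac_id)"
  define A where "A = {y \<in> Sym n. y n = n}"
  have id: "id \<in> Sym n" by (simp add: Sym_def permutes_id)
  have nonneg: "0 \<le> \<mu> t y" for t y
    by (induction t arbitrary: y) (auto simp: \<mu>_def dirac_id_def intro: walk_nonneg)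
  have mass: "(\<Sum>y\<in>Sym n. \<mu> t y) = 1" for t
    by (induction t) (use id in \<open>auto simp: \<mu>_def dirac_id_def finite_Sym sum_walk_Sym[OF assms]\<close>)
  have fixed: "(1 - 1 / real n) ^ t \<le> (\<Sum>y\<in>A. \<mu> t y)" for t
  proof (induction t)
    case 0
    then show ?case using id finite_Sym by (simp add: \<mu>_def dirac_id_def A_def)
  next
    case (Suc t)
    have "(1 - 1 / real n) ^ Suc t \<le> (1 - 1 / real n) * (\<Sum>y\<in>A. \<mu> t y)"
      using assms Suc by (auto intro: mult_left_mono)
    also have "\<dots> \<le> (\<Sum>y\<in>A. \<mu> (Suc t) y)"
      using sum_walk_fix_ge[OF assms, of "\<mu> t" k] nonneg by (simp add: \<mu>_def A_def)
    finally show ?case .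
  qed
  have "1 - real t / real n \<le> (1 - 1 / real n) ^ t"
    using Bernoulli_inequality[of "- 1 / real n" t] assms by simp
  moreover have "real (card A) / real (card (Sym n)) = 1 / real n"
  proof -
    have "fact n = real n * fact (n - 1)" using assms by (subst fact_reduce) auto
    then show ?thesis using card_fix_last[OF assms] by (simp add: A_def card_Sym)
  qed
  ultimately show ?thesis
    using tv_ge[OF mass[of t], of A] fixed[of t] by (auto simp: tv_dist_eq \<mu>_def A_def)
qed

lemma t_mix_lower:
  assumes "1 \<le> n" "1 \<le> k" "0 < \<epsilon>" "2 \<le> (1 - \<epsilon>) * real n"
  shows "(1 - \<epsilon>) / 2 * real n \<le> real (t_mix n k \<epsilon>)"
proof -
  have "1 - real (t_mix n k \<epsilon>) / real n - 1 / real n \<le> \<epsilon>"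
    using tv_dist_ge[OF assms(1)] t_mix_upper(1)[OF assms(1-3)] by (rule order_trans)
  then have "(1 - real (t_mix n k \<epsilon>) / real n - 1 / real n) * real n \<le> \<epsilon> * real n"
    by (rule mult_right_mono) simp
  moreover have "(1 - real (t_mix n k \<epsilon>) / real n - 1 / real n) * real n
      = real n - real (t_mix n k \<epsilon>) - 1"
    using assms(1) by (simp add: field_simps)
  \<comment> \<open>The mixing time is at least \<open>(1 - \<epsilon>) * n - 1\<close>, and the 1
    is at most half of \<open>(1 - \<epsilon>) * n\<close>.\<close>
  ultimately show ?thesis using assms(4) by (simp add: algebra_simps)
qed

section \<open>Asymptotic statements\<close>

lemma t_mix_le:
  assumes "3 \<le> n" "1 \<le> k" "0 < \<epsilon>"
  shows "\<epsilon> * real (t_mix n k \<epsilon>) \<le> real n + 4 * ((real n)\<^sup>2 * ln (real n) / real k)"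
proof -
  \<comment> \<open>\<open>n \<ge> 3\<close> exceeds e, so \<open>1 + ln n\<close> is at most
    \<open>2 * ln n\<close>.\<close>
  have "exp 1 \<le> real n" using exp_le assms(1) by linarith
  then have "1 \<le> ln (real n)" using assms(1) by (subst ln_ge_iff) auto
  then have "2 * (real n)\<^sup>2 * (1 + ln (real n)) / real k \<le> 2 * (real n)\<^sup>2 * (2 * ln (real n)) / real k"
    by (intro divide_right_mono mult_left_mono) auto
  then show ?thesis using t_mix_upper(2)[of n k \<epsilon>] assms by simp
qed

theorem theorem5:
  fixes \<epsilon> :: real
  assumes "0 < \<epsilon>" and "\<epsilon> < 1"
  shows
    "(\<forall>k :: nat \<Rightarrow> nat.
        (\<lambda>n. real (k n)) \<in> \<Omega>(\<lambda>n. real n * ln (real n)) \<longrightarrow>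
        (\<lambda>n. real (t_mix n (k n) \<epsilon>)) \<in> \<Theta>(\<lambda>n. real n)) \<and>
     (\<forall>k :: nat \<Rightarrow> nat.
        (\<forall>\<^sub>F n in sequentially. real n \<le> real (k n) \<and> real (k n) \<le> real n * ln (real n)) \<longrightarrow>
        (\<lambda>n. real (t_mix n (k n) \<epsilon>)) \<in> O(\<lambda>n. (real n)\<^sup>2 * ln (real n) / real (k n))) \<and>
     (\<forall>k :: nat \<Rightarrow> nat.
        (\<forall>\<^sub>F n in sequentially. 1 \<le> k n) \<longrightarrow>
        (\<lambda>n. real (t_mix n (k n) \<epsilon>)) \<in> \<Omega>(\<lambda>n. real n))"
proof (intro conjI allI impI)
  have lower: "(\<lambda>n. real (t_mix n (k n) \<epsilon>)) \<in> \<Omega>(\<lambda>n. real n)"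
    if "\<forall>\<^sub>F n in sequentially. 1 \<le> k n" for k :: "nat \<Rightarrow> nat"
  proof (rule landau_omega.bigI)
    show "0 < (1 - \<epsilon>) / 2" using assms by simp
    \<comment> \<open>The threshold is chosen to give
      \<open>2 \<le> (1 - \<epsilon>) * n\<close>.\<close>
    have "\<forall>\<^sub>F n in sequentially. max 1 (nat \<lceil>2 / (1 - \<epsilon>)\<rceil>) \<le> n"
      by (rule eventually_ge_at_top)
    with that show "\<forall>\<^sub>F n in sequentially.
        (1 - \<epsilon>) / 2 * norm (real n) \<le> norm (real (t_mix n (k n) \<epsilon>))"
    proof eventually_elim
      case (elim n)
      then have "1 \<le> n" by (metis max.bounded_iff)
      from elim have "2 / (1 - \<epsilon>) \<le> real n" by (simp add: nat_le_iff ceiling_le_iff)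
      then have "2 \<le> (1 - \<epsilon>) * real n" using assms by (simp add: field_simps)
      then show ?case using t_mix_lower[of n "k n" \<epsilon>] \<open>1 \<le> n\<close> elim assms by simp
    qed
  qed
  {
    fix k :: "nat \<Rightarrow> nat"
    assume "(\<lambda>n. real (k n)) \<in> \<Omega>(\<lambda>n. real n * ln (real n))"
    then obtain c where c: "0 < c"
      and k: "\<forall>\<^sub>F n in sequentially. c * norm (real n * ln (real n)) \<le> norm (real (k n))"
      by (rule landau_omega.bigE)
    \<comment> \<open>The growth condition makes \<open>k n\<close> positive eventually, as both
      bounds on the mixing time require.\<close>
    have ev: "\<forall>\<^sub>F n in sequentially. 3 \<le> n \<and> 0 < ln (real n) \<and> c * (real n * ln (real n)) \<le> real (k n) \<and> 1 \<le> k n"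
      using k eventually_ge_at_top[of 3]
    proof eventually_elim
      case (elim n)
      then have "0 < ln (real n)" by simp
      moreover from this have "0 < c * (real n * ln (real n))" using c elim by simp
      moreover have "c * (real n * ln (real n)) \<le> real (k n)" using elim by (simp add: abs_mult)
      ultimately show ?case using elim by (auto simp: Suc_le_eq intro: gr0I)
    qed
    have "(\<lambda>n. real (t_mix n (k n) \<epsilon>)) \<in> O(\<lambda>n. real n)"
    proof (rule landau_o.bigI)
      show "0 < (1 + 4 / c) / \<epsilon>" using c assms by (simp add: add_pos_pos)
      show "\<forall>\<^sub>F n in sequentially.
          norm (real (t_mix n (k n) \<epsilon>)) \<le> (1 + 4 / c) / \<epsilon> * norm (real n)"
        using ev
      proof eventually_elim
        case (elim n)
        have "(real n)\<^sup>2 * ln (real n) / real (k n) \<le> (real n)\<^sup>2 * ln (real n) / (c * (real n * ln (real n)))"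
          using elim c by (intro divide_left_mono) auto
        also have "\<dots> = real n / c" using elim c by (simp add: power2_eq_square)
        finally have "real n + 4 * ((real n)\<^sup>2 * ln (real n) / real (k n)) \<le> (1 + 4 / c) * real n"
          by (simp add: distrib_right)
        moreover have "\<epsilon> * real (t_mix n (k n) \<epsilon>)
            \<le> real n + 4 * ((real n)\<^sup>2 * ln (real n) / real (k n))"
          using elim assms by (intro t_mix_le) auto
        ultimately have "\<epsilon> * real (t_mix n (k n) \<epsilon>) \<le> (1 + 4 / c) * real n"
          by (rule order_trans[rotated])
        then show ?case using assms by (simp add: field_simps)
      qed
    qed
    moreover have "(\<lambda>n. real (t_mix n (k n) \<epsilon>)) \<in> \<Omega>(\<lambda>n. real n)"
      by (rule lower) (use ev in eventually_elim, simp)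
    ultimately show "(\<lambda>n. real (t_mix n (k n) \<epsilon>)) \<in> \<Theta>(\<lambda>n. real n)"
      by (rule bigthetaI)
  }
  {
    fix k :: "nat \<Rightarrow> nat"
    assume k: "\<forall>\<^sub>F n in sequentially. real n \<le> real (k n) \<and> real (k n) \<le> real n * ln (real n)"
    show "(\<lambda>n. real (t_mix n (k n) \<epsilon>)) \<in> O(\<lambda>n. (real n)\<^sup>2 * ln (real n) / real (k n))"
    proof (rule landau_o.bigI)
      \<comment> \<open>\<open>k n \<le> n * ln n\<close> makes the term \<open>n\<close> at most
        \<open>n^2 * ln n / k n\<close>; added to the 4 copies in \<open>t_mix_le\<close> this gives
        5.\<close>
      show "0 < 5 / \<epsilon>" using assms by simp
      show "\<forall>\<^sub>F n in sequentially. norm (real (t_mix n (k n) \<epsilon>))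
          \<le> 5 / \<epsilon> * norm ((real n)\<^sup>2 * ln (real n) / real (k n))"
        using k eventually_ge_at_top[of 3]
      proof eventually_elim
        case (elim n)
        define X where "X = (real n)\<^sup>2 * ln (real n) / real (k n)"
        from elim have k1: "1 \<le> k n" by simp
        have "real n * real (k n) \<le> (real n)\<^sup>2 * ln (real n)"
          using elim by (simp add: power2_eq_square mult_left_mono)
        then have "real n \<le> (real n)\<^sup>2 * ln (real n) / real (k n)"
          using k1 by (simp add: pos_le_divide_eq)
        then have "\<epsilon> * real (t_mix n (k n) \<epsilon>) \<le> 5 * X"
          using t_mix_le[of n "k n" \<epsilon>] elim k1 assms by (simp add: X_def)
        moreover have "0 \<le> X" using elim by (simp add: X_def)
        ultimately show ?case
          unfolding X_def[symmetric] using assms by (simp add: field_simps)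
      qed
    qed
  }
  fix k :: "nat \<Rightarrow> nat"
  assume "\<forall>\<^sub>F n in sequentially. 1 \<le> k n"
  then show "(\<lambda>n. real (t_mix n (k n) \<epsilon>)) \<in> \<Omega>(\<lambda>n. real n)" by (rule lower)
qed

end
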